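(* Let $x\sim\mathcal{D}$ be a random input. Fix a layer $\ell\in\{1,\dots,L\}$ with exit threshold $\phi_\ell\in[0,1]$ and a bit allocation $\boldsymbol{b}=\{b_r\}_{r=1}^L$. Let $\rho_\ell(x)$ be the full-precision exit confidence and $\tilde\rho_{\ell,\boldsymbol{b}}(x)$ the exit confidence after quantization under $\boldsymbol{b}$. Put $$\Delta_\ell(x)=\rho_\ell(x)-\phi_\ell,\qquad \xi_{\ell,\boldsymbol{b}}(x)=\tilde\rho_{\ell,\boldsymbol{b}}(x)-\rho_\ell(x),$$ $$e_\ell(x)=\mathbf{1}\{\rho_\ell(x)\ge\phi_\ell\},\qquad \tilde e_\ell(x)=\mathbf{1}\{\tilde\rho_{\ell,\boldsymbol{b}}(x)\ge\phi_\ell\}.$$ Assume that the confidence perturbation satisfies the tail bound $$\Pr\left(|\xi_{\ell,\boldsymbol{b}}(x)|>\tau_\ell\right)\le q_\ell(\tau_\ell,b_\ell)\qquad(\tau_\ell>0),$$ where $q_\ell(\tau_\ell,b_\ell)$ is non-increasing in $\tau_\ell$ and non-decreasing as $b_\ell$ decreases. Then, for any tolerance $\tau_\ell>0$, $$\Pr\left(\tilde e_\ell(x)\ne e_\ell(x)\right)\le \Pr\left(|\Delta_\ell(x)|\le\tau_\ell\right)+q_\ell(\tau_\ell,b_\ell).$$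
   Context: A network has $L$ layers; layer $\ell$ is assigned a bit-width $b_\ell$ from a finite set $\mathcal{B}$ of available bit-widths, giving the bit allocation $\boldsymbol{b}=\{b_\ell\}_{\ell=1}^L$. With $z_\ell(x)$ the full-precision logits at layer $\ell$, the exit confidence is $\rho_\ell(x)=\max_j \mathrm{softmax}(z_\ell(x))_j$; $\tilde\rho_{\ell,\boldsymbol{b}}(x)$ is the corresponding confidence of the quantized network. Both are real-valued random variables as functions of the random input $x\sim\mathcal{D}$, and all probabilities are over $x\sim\mathcal{D}$. $e_\ell(x)$ and $\tilde e_\ell(x)$ are the full-precision and quantized exit decisions at layer $\ell$. *)

theory Defs
  imports "HOL-Probability.Probability"
begin

definition softmax :: "real ^ 'k \<Rightarrow> real ^ 'k" where
  "softmax v = (\<chi> j. exp (v $ j) / (\<Sum>i\<in>UNIV. exp (v $ i)))"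

text \<open>A network is represented by its family of logit maps: \<open>z l x\<close> is the logit vector
  at layer \<open>l\<close> on input \<open>x\<close>. A quantized network is such a family \<open>zq b\<close> for each bit
  allocation \<open>b\<close>; since quantizing one layer may affect the logits at others, \<open>zq b l\<close>
  depends on the whole allocation.\<close>

definition exit_confidence :: "(nat \<Rightarrow> 'x \<Rightarrow> real ^ 'k) \<Rightarrow> nat \<Rightarrow> 'x \<Rightarrow> real" where
  "exit_confidence z l x = (MAX j. softmax (z l x) $ j)"

definition exit_decision ::
    "(nat \<Rightarrow> 'x \<Rightarrow> real ^ 'k) \<Rightarrow> (nat \<Rightarrow> real) \<Rightarrow> nat \<Rightarrow> 'x \<Rightarrow> nat" where
  "exit_decision z \<phi> l x = of_bool (exit_confidence z l x \<ge> \<phi> l)"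

definition exit_margin ::
    "(nat \<Rightarrow> 'x \<Rightarrow> real ^ 'k) \<Rightarrow> (nat \<Rightarrow> real) \<Rightarrow> nat \<Rightarrow> 'x \<Rightarrow> real" where
  "exit_margin z \<phi> l x = exit_confidence z l x - \<phi> l"

definition confidence_perturbation ::
    "(nat \<Rightarrow> 'x \<Rightarrow> real ^ 'k) \<Rightarrow> ((nat \<Rightarrow> nat) \<Rightarrow> nat \<Rightarrow> 'x \<Rightarrow> real ^ 'k)
      \<Rightarrow> (nat \<Rightarrow> nat) \<Rightarrow> nat \<Rightarrow> 'x \<Rightarrow> real" where
  "confidence_perturbation z zq b l x = exit_confidence (zq b) l x - exit_confidence z l x"

end

theory Submission
  imports Defs
begin

text \<open>Quantization can flip the exit decision only by carrying the confidence across the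
  threshold. If the margin exceeds \<open>\<tau>\<close> in absolute value and the perturbation is
  at most \<open>\<tau>\<close>, the quantized confidence stays on the same side. So every flip lies
  in the event of a small margin or in that of a large perturbation; a union bound and the tail
  bound at \<open>\<tau>\<close> finish. No independence of margin and perturbation enters.\<close>

theorem theorem1:
  fixes D :: "'x measure"
    and L l :: nat
    and B :: "nat set"
    and b :: "nat \<Rightarrow> nat"
    and z :: "nat \<Rightarrow> 'x \<Rightarrow> real ^ 'k"
    and zq :: "(nat \<Rightarrow> nat) \<Rightarrow> nat \<Rightarrow> 'x \<Rightarrow> real ^ 'k"
    and \<phi> :: "nat \<Rightarrow> real"
    and q :: "nat \<Rightarrow> real \<Rightarrow> nat \<Rightarrow> real"
    and \<tau> :: real
  assumes "prob_space D"
    and "l \<in> {1..L}"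
    and "\<phi> l \<in> {0..1}"
    and "finite B"
    and "b \<in> {1..L} \<rightarrow>\<^sub>E B"
    and "exit_confidence z l \<in> borel_measurable D"
    and "exit_confidence (zq b) l \<in> borel_measurable D"
    and tail: "\<And>t. t > 0 \<Longrightarrow>
          \<P>(x in D. \<bar>confidence_perturbation z zq b l x\<bar> > t) \<le> q l t (b l)"
    and "\<And>w. w \<in> B \<Longrightarrow> antimono_on {0<..} (\<lambda>t. q l t w)"
    and "\<And>t. t > 0 \<Longrightarrow> antimono_on B (\<lambda>w. q l t w)"
    and "\<tau> > 0"
  shows "\<P>(x in D. exit_decision (zq b) \<phi> l x \<noteq> exit_decision z \<phi> l x)
      \<le> \<P>(x in D. \<bar>exit_margin z \<phi> l x\<bar> \<le> \<tau>) + q l \<tau> (b l)"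
proof -
  interpret prob_space D by fact
  note [measurable] = assms(6,7)
  let ?near = "{x \<in> space D. \<bar>exit_margin z \<phi> l x\<bar> \<le> \<tau>}"
  let ?far = "{x \<in> space D. \<bar>confidence_perturbation z zq b l x\<bar> > \<tau>}"
  have near: "?near \<in> events"
    unfolding exit_margin_def by measurable
  have far: "?far \<in> events"
    unfolding confidence_perturbation_def by measurable
  \<comment> \<open>A changed decision puts the threshold between the two confidences, so the margin
    is at most the perturbation in absolute value.\<close>
  have "{x \<in> space D. exit_decision (zq b) \<phi> l x \<noteq> exit_decision z \<phi> l x} \<subseteq> ?near \<union> ?far"
    by (auto simp: exit_decision_def exit_margin_def confidence_perturbation_def
        of_bool_def split: if_splits)
  \<comment> \<open>Monotonicity asks for measurability of the covering set, which
    \<open>near\<close> and \<open>far\<close> supply.\<close>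
  then have "\<P>(x in D. exit_decision (zq b) \<phi> l x \<noteq> exit_decision z \<phi> l x) \<le> prob (?near \<union> ?far)"
    using near far by (intro finite_measure_mono) auto
  also have "\<dots> \<le> prob ?near + prob ?far"
    using near far by (rule measure_Un_le)
  also have "\<dots> \<le> prob ?near + q l \<tau> (b l)"
    using tail[OF \<open>\<tau> > 0\<close>] by simp
  finally show ?thesis .
qed

end
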